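(* Given a positive integer $M$, run the following algorithm. Set $(X,Y)\leftarrow(M-1,M)$ and $k\leftarrow1$. While $Y\ne k$: increment $k\leftarrow k+1$ and then (with this new $k$) update, simultaneously, $(X,Y)\leftarrow\big(X-\lfloor Y/k\rfloor,\;Y-\lfloor X/k\rfloor\big)$. Then the loop halts, and on exit $M=T_{i,j}$ with $i=X$ and $j=k-X-1$. Moreover, with $N=i+j+1$, the loop halts after exactly $N-1=i+j$ iterations (none when $M=1$), and $N-1=\Theta(\sqrt M)$ with absolute constants; consequently determining the row $i$ and column $j$ of $M$ in the array $(T_{i,j})$ costs $O(\sqrt M)$ arithmetic operations in the unit-cost model (each integer addition, subtraction, comparison and floor division counted as one operation).
   Context: For each integer $n\ge1$ let $T^{(n)}$ be the array of positive integers with entries $T^{(n)}_{i,j}$ (rows $i\ge0$, columns $0\le j<n$) defined recursively by $T^{(1)}_{q,0}=q+1$ for $q\ge0$, and, for $n\ge1$, $0\le j\le n$ and a row index written uniquely as $i=qn+r$ with $q\ge0$, $0\le r<n$, $$T^{(n+1)}_{qn+r,\,j}=\begin{cases}T^{(n)}_{q(n+1)+r,\,j}, & j+r<n,\\ T^{(n)}_{q(n+1)+r+1,\,j-1}, & j+r\ge n.\end{cases}$$ For fixed $i,j\ge0$ the entry $T^{(n)}_{i,j}$ is independent of $n$ for $n\ge i+j+1$. The Tchoukaillon array is the limiting array $T_{i,j}:=T^{(i+j+1)}_{i,j}$, $i,j\ge0$. It is known that $(i,j)\mapsto T_{i,j}$ is a bijection from $\{0,1,2,\dots\}^2$ onto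 the positive integers, so each positive integer has a unique row and column. *)

theory Defs
  imports Complex_Main
begin

(* Column indices are meaningful only for j < n; the recursion started from such an
   argument never leaves this range. The value at n = 0 is junk. *)
fun tchou_stage :: "nat \<Rightarrow> nat \<Rightarrow> nat \<Rightarrow> nat" where
  "tchou_stage 0 i j = 0"
| "tchou_stage (Suc 0) i j = i + 1"
| "tchou_stage (Suc (Suc m)) i j =
     (let n = Suc m; q = i div n; r = i mod n
      in if j + r < n then tchou_stage (Suc m) (q * (n + 1) + r) j
         else tchou_stage (Suc m) (q * (n + 1) + r + 1) (j - 1))"

definition tchou :: "nat \<Rightarrow> nat \<Rightarrow> nat" where
  "tchou i j = tchou_stage (i + j + 1) i j"

definition tchou_row :: "nat \<Rightarrow> nat" where
  "tchou_row M = (THE i. \<exists>j. tchou i j = M)"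

definition tchou_col :: "nat \<Rightarrow> nat" where
  "tchou_col M = (THE j. \<exists>i. tchou i j = M)"

(* Unit-cost model: while programs over integer variables. The only operations are integer
   addition, subtraction, floor division and comparison, and each costs one unit. Reading
   a variable or a literal and storing a result are free. *)

type_synonym vname = string
type_synonym state = "vname \<Rightarrow> int"

datatype aexp = Lit int | Var vname | Add aexp aexp | Sub aexp aexp | FloorDiv aexp aexp

fun aval :: "aexp \<Rightarrow> state \<Rightarrow> int" where
  "aval (Lit c) s = c"
| "aval (Var x) s = s x"
| "aval (Add a b) s = aval a s + aval b s"
| "aval (Sub a b) s = aval a s - aval b s"
| "aval (FloorDiv a b) s = aval a s div aval b s"

fun acost :: "aexp \<Rightarrow> nat" where
  "acost (Lit c) = 0"
| "acost (Var x) = 0"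
| "acost (Add a b) = acost a + acost b + 1"
| "acost (Sub a b) = acost a + acost b + 1"
| "acost (FloorDiv a b) = acost a + acost b + 1"

(* Assign is simultaneous: all right-hand sides are evaluated in the old state.
   WhileNeq a b c repeats c as long as the values of a and b differ. *)
datatype com = Assign "(vname \<times> aexp) list" | Seq com com | WhileNeq aexp aexp com

definition assign :: "(vname \<times> aexp) list \<Rightarrow> state \<Rightarrow> state" where
  "assign us s = (\<lambda>x. case map_of us x of None \<Rightarrow> s x | Some a \<Rightarrow> aval a s)"

(* exec c s p n t: started in s, the program c halts in t, having performed p operations
   and n loop iterations in total. *)
inductive exec :: "com \<Rightarrow> state \<Rightarrow> nat \<Rightarrow> nat \<Rightarrow> state \<Rightarrow> bool" where
  Assign: "exec (Assign us) s (\<Sum>(x, a)\<leftarrow>us. acost a) 0 (assign us s)"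
| Seq: "exec c s p n s' \<Longrightarrow> exec d s' p' n' t \<Longrightarrow> exec (Seq c d) s (p + p') (n + n') t"
| WhileExit: "aval a s = aval b s \<Longrightarrow> exec (WhileNeq a b c) s (acost a + acost b + 1) 0 s"
| WhileStep: "aval a s \<noteq> aval b s \<Longrightarrow> exec c s p n s' \<Longrightarrow>
    exec (WhileNeq a b c) s' p' n' t \<Longrightarrow>
    exec (WhileNeq a b c) s (acost a + acost b + 1 + p + p') (1 + n + n') t"

lemma exec_deterministic:
  "exec c s p n t \<Longrightarrow> exec c s p' n' t' \<Longrightarrow> p' = p \<and> n' = n \<and> t' = t"
proof (induction arbitrary: p' n' t' rule: exec.induct)
  case (Assign us s)
  then show ?case by (auto elim: exec.cases)
next
  case (Seq c s p n s' d q m t)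
  from Seq.prems show ?case
    by (cases rule: exec.cases) (use Seq.IH in blast)
next
  case (WhileExit a s b c)
  from WhileExit.prems show ?case
    by (cases rule: exec.cases) (use WhileExit.hyps in auto)
next
  case (WhileStep a s b c p n s' q m t)
  from WhileStep.prems show ?case
    by (cases rule: exec.cases) (use WhileStep.hyps WhileStep.IH in blast)+
qed

definition tchou_loop :: com where
  "tchou_loop = WhileNeq (Var ''Y'') (Var ''k'')
     (Seq (Assign [(''k'', Add (Var ''k'') (Lit 1))])
          (Assign [(''X'', Sub (Var ''X'') (FloorDiv (Var ''Y'') (Var ''k''))),
                   (''Y'', Sub (Var ''Y'') (FloorDiv (Var ''X'') (Var ''k'')))]))"

(* The input is held in the variable M. *)
definition tchou_search :: com where
  "tchou_search =
     Seq (Assign [(''X'', Sub (Var ''M'') (Lit 1)), (''Y'', Var ''M''), (''k'', Lit 1)])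
         tchou_loop"

definition tchou_locate :: com where
  "tchou_locate =
     Seq tchou_search
         (Assign [(''i'', Var ''X''), (''j'', Sub (Sub (Var ''k'') (Var ''X'')) (Lit 1))])"

end

theory Submission
  imports Defs
begin

text \<open>
  Passing from stage \<open>n\<close> to stage \<open>n + 1\<close> moves the number in row \<open>x\<close>, column \<open>j\<close>. In terms of \<open>x\<close>
  and \<open>y = x + j + 1\<close> the move is exactly the loop body
  \<open>(x, y) \<mapsto> (x - \<lfloor>y/(n+1)\<rfloor>, y - \<lfloor>x/(n+1)\<rfloor>)\<close>, so the loop follows \<open>M\<close> through the stages; it
  stops when \<open>y = n\<close>, that is \<open>n = i + j + 1\<close>, where the entry belongs to the limiting array.
  Writing \<open>y\<^sub>k\<close> for the value of \<open>y\<close> at stage \<open>k\<close>, the estimates \<open>y - k \<le> x < y\<close> give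
  \<open>M \<le> k y\<^sub>k \<le> M + k (k - 1)\<close> by induction. At the halting stage \<open>N\<close> the left inequality yields
  \<open>M \<le> N\<^sup>2\<close>; since \<open>y\<^sub>k \<ge> N\<close> for \<open>k \<le> N\<close>, the right one with \<open>k\<close> about \<open>N/2\<close> yields \<open>N\<^sup>2 \<le> 4 M\<close>.
\<close>

text \<open>Index \<open>m\<close> corresponds to the value \<open>k = m + 1\<close> of the loop counter and to stage \<open>m + 1\<close>.\<close>

fun orbit :: "nat \<Rightarrow> nat \<Rightarrow> int \<times> int" where
  "orbit M 0 = (int M - 1, int M)"
| "orbit M (Suc m) =
     (fst (orbit M m) - snd (orbit M m) div (int m + 2),
      snd (orbit M m) - fst (orbit M m) div (int m + 2))"

section \<open>The loop body as inverse of the stage recursion\<close>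

text \<open>Since \<open>r + j + 1 < 2 * (m + 2)\<close>, adding \<open>j + 1\<close> to the row
  causes at most one carry. It occurs exactly when the second branch of the recursion
  applies.\<close>

lemma move_div:
  fixes q r j m :: nat
  assumes "r \<le> m + 1" "j \<le> m"
  shows "int (q * (m + 2) + r) div (int m + 2) = int q"
    and "int (q * (m + 2) + r + j + 1) div (int m + 2) = int q + (if j + r \<le> m then 0 else 1)"
proof -
  show "int (q * (m + 2) + r) div (int m + 2) = int q"
    by (rule int_div_pos_eq[where r = "int r"]) (use assms in \<open>auto simp: algebra_simps\<close>)
  show "int (q * (m + 2) + r + j + 1) div (int m + 2) = int q + (if j + r \<le> m then 0 else 1)"
  proof (cases "j + r \<le> m")
    case True
    show ?thesis
      by (rule int_div_pos_eq[where r = "int (r + j + 1)"])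
        (use assms True in \<open>auto simp: algebra_simps\<close>)
  next
    case False
    show ?thesis
      by (rule int_div_pos_eq[where r = "int r + int j - int m - 1"])
        (use assms False in \<open>auto simp: algebra_simps\<close>)
  qed
qed

lemma stage_move:
  assumes "r < m + 1"
  shows "tchou_stage (Suc (Suc m)) (q * (m + 1) + r) j =
    (if j + r \<le> m then tchou_stage (Suc m) (q * (m + 2) + r) j
     else tchou_stage (Suc m) (q * (m + 2) + r + 1) (j - 1))"
proof -
  have "(q * (m + 1) + r) div Suc m = q" "(q * (m + 1) + r) mod Suc m = r"
    using assms div_mult_self3[of "m + 1" q r] mod_mult_self3[of q "m + 1" r]
    by (simp_all del: div_mult_self3 mod_mult_self3 mult_Suc_right)
  then show ?thesis
    by (simp add: Let_def less_Suc_eq_le del: mult_Suc_right)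
qed

text \<open>Every positive \<open>M\<close> occurs in every stage, by induction along the loop:
  without a carry the row drops by \<open>q\<close> and the column stays; with one the row drops by
  \<open>q + 1\<close> and the column grows by 1.\<close>

lemma orbit_stage:
  assumes "M \<ge> 1"
  shows "\<exists>i j. j \<le> m \<and> orbit M m = (int i, int (i + j + 1)) \<and> tchou_stage (Suc m) i j = M"
proof (induction m)
  case 0
  show ?case
    by (rule exI[of _ "M - 1"], rule exI[of _ 0]) (use assms in auto)
next
  case (Suc m)
  then obtain x j where j: "j \<le> m" and orb: "orbit M m = (int x, int (x + j + 1))"
    and M: "tchou_stage (Suc m) x j = M"
    by blast
  define q r where "q = x div (m + 2)" and "r = x mod (m + 2)"
  have x: "x = q * (m + 2) + r" and r: "r \<le> m + 1"
    using mod_less_divisor[of "m + 2" x] unfolding q_def r_def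
    by (simp_all only: div_mult_mod_eq) linarith
  note d = move_div[OF r j, of q, folded x]
  show ?case
  proof (cases "j + r \<le> m")
    case True
    show ?thesis
      by (rule exI[of _ "q * (m + 1) + r"], rule exI[of _ j])
        (use True j d orb M x stage_move[of r m q j] in
          \<open>auto simp: algebra_simps simp del: tchou_stage.simps\<close>)
  next
    case False
    \<comment> \<open>A carry forces \<open>r > 0\<close>. The new remainder is
      \<open>r - 1\<close>, as the second branch looks one row further down.\<close>
    then obtain r' where r': "r = r' + 1"
      using j by (cases r) auto
    show ?thesis
      by (rule exI[of _ "q * (m + 1) + r'"], rule exI[of _ "j + 1"])
        (use False r r' j d orb M x stage_move[of r' m q "j + 1"] in
          \<open>auto simp: algebra_simps simp del: tchou_stage.simps\<close>)
  qed
qed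

text \<open>Unfolding the recursion goes back one stage, and the loop body undoes this. Hence an
  entry determines its position, the source of injectivity.\<close>

lemma orbit_of_stage:
  assumes "j \<le> m"
  shows "orbit (tchou_stage (Suc m) i j) m = (int i, int (i + j + 1))"
  using assms
proof (induction m arbitrary: i j)
  case 0
  then show ?case by simp
next
  case (Suc m)
  define q r where "q = i div (m + 1)" and "r = i mod (m + 1)"
  have i: "i = q * (m + 1) + r" and r: "r < m + 1"
    using mod_less_divisor[of "m + 1" i] unfolding q_def r_def
    by (simp_all only: div_mult_mod_eq)
  note st = stage_move[OF r, of q j, folded i]
  show ?case
  proof (cases "j + r \<le> m")
    case True
    then have "orbit (tchou_stage (Suc (Suc m)) i j) m =
        (int (q * (m + 2) + r), int (q * (m + 2) + r + j + 1))"
      using st Suc.IH[of j "q * (m + 2) + r"] by simp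
    then show ?thesis
      using move_div[of r m j q] True i by (simp add: algebra_simps del: tchou_stage.simps)
  next
    case False
    then obtain j' where j': "j = j' + 1"
      using r by (cases j) auto
    have "orbit (tchou_stage (Suc (Suc m)) i j) m =
        (int (q * (m + 2) + (r + 1)), int (q * (m + 2) + (r + 1) + j' + 1))"
      using st Suc.IH[of j' "q * (m + 2) + r + 1"] False j' Suc.prems
      by (simp del: tchou_stage.simps)
    then show ?thesis
      using move_div[of "r + 1" m j' q] False i j' r Suc.prems
      by (simp add: algebra_simps del: tchou_stage.simps)
  qed
qed

section \<open>Halting and size of the halting index\<close>

lemma orbit_bounds:
  assumes "M \<ge> 1"
  shows "0 \<le> fst (orbit M m)" "fst (orbit M m) < snd (orbit M m)"
    "snd (orbit M m) \<le> fst (orbit M m) + int m + 1"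
  using orbit_stage[OF assms, of m] by auto

lemma snd_orbit_antimono:
  assumes "M \<ge> 1" "m \<le> n"
  shows "snd (orbit M n) \<le> snd (orbit M m)"
  using assms(2)
proof (induction n rule: dec_induct)
  case (step n)
  have "0 \<le> fst (orbit M n) div (int n + 2)"
    using orbit_bounds(1)[OF assms(1), of n] by (simp add: pos_imp_zdiv_nonneg_iff)
  with step show ?case by simp
qed simp

text \<open>The loop cannot jump over the equality \<open>Y = k\<close>: if
  \<open>q \<ge> 1\<close>, then \<open>y - q > x - q \<ge> (m + 1) * q \<ge> m + 1\<close>.\<close>

lemma snd_orbit_step_ge:
  assumes "M \<ge> 1" "snd (orbit M m) > int m + 1"
  shows "snd (orbit M (Suc m)) \<ge> int m + 2"
proof -
  define x y q where "x = fst (orbit M m)" and "y = snd (orbit M m)" and "q = x div (int m + 2)"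
  have q: "(int m + 2) * q \<le> x"
    using pos_mod_sign[of "int m + 2" x] mult_div_mod_eq[of "int m + 2" x]
    unfolding q_def by linarith
  have q0: "0 \<le> q"
    using orbit_bounds(1)[OF assms(1), of m] by (simp add: q_def x_def pos_imp_zdiv_nonneg_iff)
  have "y - q \<ge> int m + 2"
  proof (cases "q = 0")
    case True
    then show ?thesis using assms(2) by (simp add: y_def)
  next
    case False
    then have "(int m + 1) * 1 \<le> (int m + 1) * q"
      using q0 by (intro mult_left_mono) auto
    then show ?thesis
      using q orbit_bounds(2)[OF assms(1), of m] by (simp add: x_def y_def algebra_simps)
  qed
  then show ?thesis by (simp add: x_def y_def q_def)
qed

text \<open>In one step the product \<open>k * y\<close> changes by \<open>y - (m + 2) * q\<close>,
  which equals \<open>y - x\<close> plus the remainder of \<open>x\<close> modulo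
  \<open>m + 2\<close>. This lies between 1 and \<open>2 * (m + 1)\<close>, and these upper bounds
  sum to \<open>(m + 1) * m\<close>.\<close>

lemma orbit_weight_bounds:
  assumes "M \<ge> 1"
  shows "int M \<le> (int m + 1) * snd (orbit M m)"
    and "(int m + 1) * snd (orbit M m) \<le> int M + (int m + 1) * int m"
proof (induction m)
  case 0
  case 1 show ?case by simp
  case 2 show ?case by simp
next
  case (Suc m)
  define x y q where "x = fst (orbit M m)" and "y = snd (orbit M m)" and "q = x div (int m + 2)"
  have q: "(int m + 2) * q \<le> x" "x - (int m + 1) \<le> (int m + 2) * q"
    using pos_mod_bound[of "int m + 2" x] pos_mod_sign[of "int m + 2" x]
      mult_div_mod_eq[of "int m + 2" x]
    unfolding q_def by linarith+
  have xy: "x < y" "y \<le> x + int m + 1"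
    using orbit_bounds[OF assms, of m] by (simp_all add: x_def y_def)
  have s: "snd (orbit M (Suc m)) = y - q"
    by (simp add: x_def y_def q_def)
  case 1
  show ?case
    using Suc.IH(1) q(1) xy(1) unfolding s y_def[symmetric] by (simp add: algebra_simps)
  case 2
  show ?case
    using Suc.IH(2) q(2) xy(2) unfolding s y_def[symmetric] by (simp add: algebra_simps)
qed

lemma orbit_halts:
  assumes "M \<ge> 1"
  obtains n where "snd (orbit M n) = int n + 1" "\<And>m. m < n \<Longrightarrow> snd (orbit M m) \<noteq> int m + 1"
proof -
  define P where "P n \<longleftrightarrow> snd (orbit M n) \<le> int n + 1" for n
  define n where "n = (LEAST n. P n)"
  \<comment> \<open>\<open>y\<close> starts at \<open>M\<close> and never grows, while the counter
    reaches \<open>M + 1\<close>.\<close>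
  have "P M"
    using snd_orbit_antimono[OF assms, of 0 M] by (simp add: P_def)
  then have n: "P n"
    unfolding n_def by (rule LeastI)
  have less: "\<not> P m" if "m < n" for m
    using that not_less_Least unfolding n_def by blast
  have "snd (orbit M n) \<ge> int n + 1"
  proof (cases n)
    case 0
    then show ?thesis using assms by simp
  next
    case (Suc m)
    then show ?thesis
      using snd_orbit_step_ge[OF assms, of m] less[of m] by (simp add: P_def del: orbit.simps)
  qed
  then show thesis
    using that[of n] n less by (force simp: P_def)
qed

lemma halting_index_bounds:
  assumes "M \<ge> 1" "snd (orbit M n) = int n + 1"
  shows "M \<le> (n + 1)\<^sup>2" "(n + 1)\<^sup>2 \<le> 4 * M"
proof -
  have "int M \<le> int ((n + 1)\<^sup>2)"
    using orbit_weight_bounds(1)[OF assms(1), of n] assms(2)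
    by (simp add: power2_eq_square algebra_simps)
  then show "M \<le> (n + 1)\<^sup>2"
    by (simp only: of_nat_le_iff)
  \<comment> \<open>The two factors of \<open>(m + 1) * (n + 1 - m)\<close> have sum
    \<open>n + 2\<close>; halving \<open>n\<close> balances them, so the product is at least a
    quarter of \<open>(n + 1)\<close> squared.\<close>
  define m where "m = n div 2"
  have mn: "m \<le> n" and n: "n = 2 * m \<or> n = 2 * m + 1"
    by (auto simp: m_def)
  have "(int m + 1) * (int n + 1) \<le> (int m + 1) * snd (orbit M m)"
    using snd_orbit_antimono[OF assms(1) mn] assms(2) by (intro mult_left_mono) auto
  also have "\<dots> \<le> int M + (int m + 1) * int m"
    by (rule orbit_weight_bounds(2)[OF assms(1)])
  finally have "(int m + 1) * (int n + 1 - int m) \<le> int M"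
    by (simp add: algebra_simps)
  then have "(int n + 1)\<^sup>2 \<le> 4 * int M"
    using n by (auto simp: power2_eq_square algebra_simps)
  then have "int ((n + 1)\<^sup>2) \<le> int (4 * M)"
    by (simp add: add.commute)
  then show "(n + 1)\<^sup>2 \<le> 4 * M"
    by (simp only: of_nat_le_iff)
qed

section \<open>Positions in the limiting array\<close>

lemma tchou_eq_iff_orbit:
  assumes "M \<ge> 1"
  shows "tchou i j = M \<longleftrightarrow> orbit M (i + j) = (int i, int (i + j + 1))"
proof
  assume "tchou i j = M"
  then show "orbit M (i + j) = (int i, int (i + j + 1))"
    using orbit_of_stage[of j "i + j" i] by (simp add: tchou_def del: tchou_stage.simps)
next
  assume "orbit M (i + j) = (int i, int (i + j + 1))"
  then show "tchou i j = M"
    using orbit_stage[OF assms, of "i + j"] by (auto simp: tchou_def simp del: tchou_stage.simps)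
qed

text \<open>\<open>y\<close> never grows while the counter strictly increases, so they meet at most
  once.\<close>

lemma halting_index_unique:
  assumes "M \<ge> 1" "snd (orbit M m) = int m + 1" "snd (orbit M n) = int n + 1"
  shows "m = n"
  using snd_orbit_antimono[OF assms(1), of m n] snd_orbit_antimono[OF assms(1), of n m] assms
  by linarith

lemma tchou_inj:
  assumes "M \<ge> 1" "tchou i j = M" "tchou i' j' = M"
  shows "i' = i \<and> j' = j"
proof -
  have o: "orbit M (i + j) = (int i, int (i + j + 1))"
    "orbit M (i' + j') = (int i', int (i' + j' + 1))"
    using assms tchou_eq_iff_orbit by blast+
  then have "i + j = i' + j'"
    using halting_index_unique[OF assms(1), of "i + j" "i' + j'"] by simp
  with o show ?thesis by simp
qed

lemma tchou_row_col:
  assumes "M \<ge> 1" "tchou i j = M"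
  shows "tchou_row M = i" "tchou_col M = j"
  unfolding tchou_row_def tchou_col_def using tchou_inj[OF assms] assms(2) by blast+

section \<open>Execution and operation count\<close>

text \<open>Induction on the number \<open>d\<close> of remaining iterations. Each costs one
  comparison and five operations in the body; the exit test costs one more.\<close>

lemma exec_tchou_loop:
  assumes "\<And>m'. m \<le> m' \<Longrightarrow> m' < m + d \<Longrightarrow> snd (orbit M m') \<noteq> int m' + 1"
    and "snd (orbit M (m + d)) = int (m + d) + 1"
    and "s ''X'' = fst (orbit M m)" "s ''Y'' = snd (orbit M m)" "s ''k'' = int m + 1"
  shows "\<exists>t. exec tchou_loop s (6 * d + 1) d t \<and>
    t ''X'' = fst (orbit M (m + d)) \<and> t ''k'' = int (m + d) + 1"
  using assms
proof (induction d arbitrary: m s)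
  case 0
  then have "exec tchou_loop s (acost (Var ''Y'') + acost (Var ''k'') + 1) 0 s"
    unfolding tchou_loop_def by (intro exec.WhileExit) auto
  with 0 show ?case by auto
next
  case (Suc d)
  let ?inc = "[(''k'', Add (Var ''k'') (Lit 1))]"
  let ?upd = "[(''X'', Sub (Var ''X'') (FloorDiv (Var ''Y'') (Var ''k''))),
               (''Y'', Sub (Var ''Y'') (FloorDiv (Var ''X'') (Var ''k'')))]"
  define s' where "s' = assign ?upd (assign ?inc s)"
  have body: "exec (Seq (Assign ?inc) (Assign ?upd)) s 5 0 s'"
    using exec.Seq[OF exec.Assign[of ?inc s] exec.Assign[of ?upd "assign ?inc s"]]
    by (simp add: s'_def numeral_eq_Suc)
  have neq: "aval (Var ''Y'') s \<noteq> aval (Var ''k'') s"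
    using Suc.prems by auto
  have "\<exists>t. exec tchou_loop s' (6 * d + 1) d t \<and>
      t ''X'' = fst (orbit M (Suc m + d)) \<and> t ''k'' = int (Suc m + d) + 1"
  proof (rule Suc.IH)
    show "snd (orbit M m') \<noteq> int m' + 1" if "Suc m \<le> m'" "m' < Suc m + d" for m'
      using Suc.prems(1)[of m'] that by simp
    show "snd (orbit M (Suc m + d)) = int (Suc m + d) + 1"
      using Suc.prems(2) by simp
  qed (use Suc.prems(3-5) in \<open>auto simp: s'_def assign_def algebra_simps\<close>)
  then obtain t where t: "exec tchou_loop s' (6 * d + 1) d t"
    "t ''X'' = fst (orbit M (Suc m + d))" "t ''k'' = int (Suc m + d) + 1"
    by blast
  have "exec tchou_loop s (6 * Suc d + 1) (Suc d) t"
    using exec.WhileStep[OF neq body t(1)[unfolded tchou_loop_def]]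
    by (simp add: tchou_loop_def)
  with t show ?case by auto
qed

lemma exec_tchou_search:
  assumes "M \<ge> 1" "s ''M'' = int M"
  obtains i j t where "exec tchou_search s (6 * (i + j) + 2) (i + j) t"
    "t ''X'' = int i" "t ''k'' = int (i + j) + 1" "tchou i j = M"
    "M \<le> (i + j + 1)\<^sup>2" "(i + j + 1)\<^sup>2 \<le> 4 * M"
proof -
  obtain n where n: "snd (orbit M n) = int n + 1" "\<And>m. m < n \<Longrightarrow> snd (orbit M m) \<noteq> int m + 1"
    using orbit_halts[OF assms(1)] by blast
  let ?init = "[(''X'', Sub (Var ''M'') (Lit 1)), (''Y'', Var ''M''), (''k'', Lit 1)]"
  have "\<exists>t. exec tchou_loop (assign ?init s) (6 * n + 1) n t \<and>
      t ''X'' = fst (orbit M (0 + n)) \<and> t ''k'' = int (0 + n) + 1"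
    by (rule exec_tchou_loop) (use n assms(2) in \<open>auto simp: assign_def\<close>)
  then obtain t where t: "exec tchou_loop (assign ?init s) (6 * n + 1) n t"
    "t ''X'' = fst (orbit M n)" "t ''k'' = int n + 1"
    by auto
  have search: "exec tchou_search s (6 * n + 2) n t"
    using exec.Seq[OF exec.Assign[of ?init s] t(1)] by (simp add: tchou_search_def)
  obtain i j where ij: "orbit M n = (int i, int (i + j + 1))"
    using orbit_stage[OF assms(1), of n] by blast
  then have nij: "n = i + j"
    using n(1) by simp
  with ij have "tchou i j = M"
    using tchou_eq_iff_orbit[OF assms(1)] by blast
  then show thesis
    using that[of i j t] search t ij halting_index_bounds[OF assms(1) n(1)] unfolding nij by simp
qed

theorem proposition3:
  shows "\<exists>c C K :: real. c > 0 \<and> C > 0 \<and> K > 0 \<and>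
    (\<forall>(M :: nat) s. M \<ge> 1 \<longrightarrow> s ''M'' = int M \<longrightarrow>
       (\<exists>p N i j t. exec tchou_search s p (N - 1) t \<and>
          t ''X'' = int i \<and> t ''k'' - t ''X'' - 1 = int j \<and> M = tchou i j \<and>
          N = i + j + 1 \<and> (M = 1 \<longrightarrow> N - 1 = 0) \<and>
          (M \<ge> 2 \<longrightarrow> c * sqrt (real M) \<le> real (N - 1)) \<and>
          real (N - 1) \<le> C * sqrt (real M)) \<and>
       (\<exists>p n t. exec tchou_locate s p n t \<and>
          t ''i'' = int (tchou_row M) \<and> t ''j'' = int (tchou_col M) \<and>
          real p \<le> K * sqrt (real M)))"
\<comment> \<open>The 2 is the root of the 4 in \<open>N * N \<le> 4 * M\<close>. The 16 suffices
  because the cost is \<open>6 * (N - 1) + 4\<close>, with \<open>N - 1 \<le> 2 * sqrt M\<close> and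
  \<open>1 \<le> sqrt M\<close>.\<close>
proof (rule exI[of _ "1 / 2"], rule exI[of _ 2], rule exI[of _ 16], intro conjI allI impI)
  fix M :: nat and s :: state
  assume M: "M \<ge> 1" and s: "s ''M'' = int M"
  from exec_tchou_search[of M s, OF M s]
  obtain i j t where ex: "exec tchou_search s (6 * (i + j) + 2) (i + j) t"
    and t: "t ''X'' = int i" "t ''k'' = int (i + j) + 1" and T: "tchou i j = M"
    and b: "M \<le> (i + j + 1)\<^sup>2" "(i + j + 1)\<^sup>2 \<le> 4 * M"
    by blast
  have "sqrt (real M) \<le> sqrt ((real (i + j + 1))\<^sup>2)"
    using b(1) by (metis of_nat_le_iff of_nat_power real_sqrt_le_iff)
  then have lower: "sqrt (real M) \<le> real (i + j + 1)"
    by simp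
  have "(real (i + j + 1))\<^sup>2 \<le> 4 * real M"
    using b(2) by (metis of_nat_le_iff of_nat_mult of_nat_numeral of_nat_power)
  then have "real (i + j + 1) \<le> sqrt (4 * real M)"
    by (rule real_le_rsqrt)
  then have upper: "real (i + j + 1) \<le> 2 * sqrt (real M)"
    by (simp add: real_sqrt_mult)
  have one: "M = 1" if "i + j = 0"
    using b(1) M that by simp
  have zero: "i + j = 0" if "M = 1"
    using tchou_inj[OF M T, of 0 0] that by (simp add: tchou_def)
  have ge: "1 / 2 * sqrt (real M) \<le> real (i + j)" if "M \<ge> 2"
  proof -
    have "i + j \<noteq> 0"
    proof
      assume "i + j = 0"
      with one that show False by simp
    qed
    \<comment> \<open>This gives \<open>i + j + 1 \<le> 2 * (i + j)\<close>, whence the constant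
      \<open>1 / 2\<close>.\<close>
    then have "real (i + j) \<ge> 1" by linarith
    then show ?thesis using lower by simp
  qed
  show "\<exists>p N i j t. exec tchou_search s p (N - 1) t \<and>
          t ''X'' = int i \<and> t ''k'' - t ''X'' - 1 = int j \<and> M = tchou i j \<and>
          N = i + j + 1 \<and> (M = 1 \<longrightarrow> N - 1 = 0) \<and>
          (M \<ge> 2 \<longrightarrow> 1 / 2 * sqrt (real M) \<le> real (N - 1)) \<and>
          real (N - 1) \<le> 2 * sqrt (real M)"
    by (rule exI[of _ "6 * (i + j) + 2"], rule exI[of _ "i + j + 1"], rule exI[of _ i],
        rule exI[of _ j], rule exI[of _ t])
      (use ex t T zero ge upper in auto)
  let ?out = "[(''i'', Var ''X''), (''j'', Sub (Sub (Var ''k'') (Var ''X'')) (Lit 1))]"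
  have "exec tchou_locate s (6 * (i + j) + 4) (i + j) (assign ?out t)"
    using exec.Seq[OF ex exec.Assign[of ?out t]] by (simp add: tchou_locate_def numeral_eq_Suc)
  moreover have "sqrt (real M) \<ge> 1"
    using M by simp
  then have "real (6 * (i + j) + 4) \<le> 16 * sqrt (real M)"
    using upper by simp
  ultimately show "\<exists>p n t. exec tchou_locate s p n t \<and>
          t ''i'' = int (tchou_row M) \<and> t ''j'' = int (tchou_col M) \<and>
          real p \<le> 16 * sqrt (real M)"
    using t tchou_row_col[OF M T]
    by (intro exI[of _ "6 * (i + j) + 4"] exI[of _ "i + j"] exI[of _ "assign ?out t"])
      (auto simp: assign_def)
qed auto

end
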